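(* Let $\alpha=\frac{1+\sqrt5}{2}$. For every non-negative integer $n$ and all integers $j$, $r$, $s$, \[ \sum_{k = 0}^{n} (- 1)^k \binom {2n}{2k} F_{j(2rk + s)} = \begin{cases} \sqrt{5^n} F_{jr}^n F_{jrn + js} \cos \big(2n\arctan (\alpha ^{jr})\big), & \text{$jr$ odd;}\\ L_{jr}^n F_{jrn + js} \cos \big(2n\arctan (\alpha ^{jr} )\big), & \text{$jr$ even, $n$ even;}\\ \frac{1}{\sqrt5}L_{jr}^n L_{jrn + js} \cos\big (2n\arctan (\alpha ^{jr} )\big), & \text{$jr$ even, $n$ odd,} \end{cases} \] \[ \sum_{k = 0}^{n} (- 1)^k \binom {2n}{2k} L_{j(2rk + s)} = \begin{cases} \sqrt{5^n} F_{jr}^n L_{jrn + js} \cos \big(2n\arctan (\alpha ^{jr} )\big), & \text{$jr$ odd;}\\ L_{jr}^n L_{jrn + js} \cos \big(2n\arctan (\alpha ^{jr} )\big), & \text{$jr$ even, $n$ even;}\\ \sqrt5L_{jr}^n F_{jrn + js} \cos \big(2n\arctan (\alpha ^{jr} )\big), & \text{$jr$ even, $n$ odd.} \end{cases} \]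
   Context: The Fibonacci numbers $F_j$ and Lucas numbers $L_j$ are defined for all integers $j$ by $F_0=0$, $F_1=1$, $L_0=2$, $L_1=1$, $F_j=F_{j-1}+F_{j-2}$, $L_j=L_{j-1}+L_{j-2}$, with $F_{-j}=(-1)^{j-1}F_j$ and $L_{-j}=(-1)^jL_j$. Here $\arctan$ is the real arctangent with values in $(-\pi/2,\pi/2)$. *)

theory Defs
  imports Complex_Main "HOL-Number_Theory.Fib"
begin

fun lucas :: "nat \<Rightarrow> nat" where
  "lucas 0 = 2"
| "lucas (Suc 0) = 1"
| "lucas (Suc (Suc n)) = lucas (Suc n) + lucas n"

definition fib_int :: "int \<Rightarrow> int" where
  "fib_int j = (if j \<ge> 0 then int (fib (nat j))
                else (-1) ^ (nat (- j) - 1) * int (fib (nat (- j))))"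

definition lucas_int :: "int \<Rightarrow> int" where
  "lucas_int j = (if j \<ge> 0 then int (lucas (nat j))
                  else (-1) ^ nat (- j) * int (lucas (nat (- j))))"

lemma fib_int_0 [simp]: "fib_int 0 = 0"
  and fib_int_1 [simp]: "fib_int 1 = 1"
  and lucas_int_0 [simp]: "lucas_int 0 = 2"
  and lucas_int_1 [simp]: "lucas_int 1 = 1"
  by (simp_all add: fib_int_def lucas_int_def)

lemma int_ge2_or_neg_cases:
  fixes j :: int
  obtains (ge2) n where "j = int n + 2" | (one) "j = 1" | (nonpos) n where "j = - int n"
proof -
  consider "j \<ge> 2" | "j = 1" | "j \<le> 0" by linarith
  then show thesis
  proof cases
    case 1
    then have "j = int (nat (j - 2)) + 2" by simp
    then show ?thesis by (rule ge2)
  next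
    case 2
    then show ?thesis by (rule one)
  next
    case 3
    then have "j = - int (nat (- j))" by simp
    then show ?thesis by (rule nonpos)
  qed
qed

lemma fib_int_of_nat [simp]: "fib_int (int n) = int (fib n)"
  and lucas_int_of_nat [simp]: "lucas_int (int n) = int (lucas n)"
  by (simp_all add: fib_int_def lucas_int_def)

lemma fib_int_minus: "fib_int (- int n) = (-1) ^ Suc n * int (fib n)"
  by (cases n) (simp_all add: fib_int_def nat_add_distrib)

lemma lucas_int_minus: "lucas_int (- int n) = (-1) ^ n * int (lucas n)"
  by (cases n) (simp_all add: lucas_int_def nat_add_distrib)

lemma fib_int_rec: "fib_int j = fib_int (j - 1) + fib_int (j - 2)"
proof (cases j rule: int_ge2_or_neg_cases)
  case (ge2 n)
  then have "j = int (Suc (Suc n))" "j - 1 = int (Suc n)" "j - 2 = int n" by simp_all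
  then show ?thesis by (simp only: fib_int_of_nat) simp
next
  case one
  then show ?thesis by (simp add: fib_int_def)
next
  case (nonpos n)
  then have "j = - int n" "j - 1 = - int (Suc n)" "j - 2 = - int (Suc (Suc n))" by simp_all
  then show ?thesis by (simp only: fib_int_minus) (simp add: algebra_simps)
qed

lemma lucas_int_rec: "lucas_int j = lucas_int (j - 1) + lucas_int (j - 2)"
proof (cases j rule: int_ge2_or_neg_cases)
  case (ge2 n)
  then have "j = int (Suc (Suc n))" "j - 1 = int (Suc n)" "j - 2 = int n" by simp_all
  then show ?thesis by (simp only: lucas_int_of_nat) simp
next
  case one
  then show ?thesis by (simp add: lucas_int_def)
next
  case (nonpos n)
  then have "j = - int n" "j - 1 = - int (Suc n)" "j - 2 = - int (Suc (Suc n))" by simp_all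
  then show ?thesis by (simp only: lucas_int_minus) (simp add: algebra_simps)
qed

end

theory Submission
  imports Defs
begin

text \<open>
  By Binet's formulas both sums are combinations of the sums
  \<open>\<Sum>k\<le>n. (-1)\<^sup>k (2n choose 2k) x\<^sup>2\<^sup>k = Re ((1 + \<i> x)\<^sup>2\<^sup>n) = (1 + x\<^sup>2)\<^sup>n cos (2n arctan x)\<close>
  at \<open>x = \<alpha>\<^sup>m\<close> and \<open>x = \<beta>\<^sup>m\<close>, where \<open>m = j r\<close> and \<open>\<beta> = -1/\<alpha>\<close>. Since
  \<open>\<beta>\<^sup>m = \<plusminus>1/\<alpha>\<^sup>m\<close>, the two arctangents have sum or difference \<open>\<pi>/2\<close>, so the two cosines agree up to \<open>(-1)\<^sup>n\<close>; and \<open>1 + x\<^sup>2\<close> is \<open>x (\<alpha>\<^sup>m + \<beta>\<^sup>m)\<close> for even \<open>m\<close>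
  and \<open>\<plusminus>x (\<alpha>\<^sup>m - \<beta>\<^sup>m)\<close> for odd \<open>m\<close>.
\<close>

lemma sum_alternating_even_binomial:
  fixes x :: real
  shows "(\<Sum>k = 0..n. (-1) ^ k * real ((2 * n) choose (2 * k)) * (x ^ 2) ^ k) =
    (1 + x\<^sup>2) ^ n * cos (2 * real n * arctan x)"
proof -
  \<comment> \<open>\<open>t k\<close> is the k-th term of the binomial expansion of (1 + i x)^(2n);
    its real part vanishes for odd \<open>k\<close> and is the wanted summand for even
    \<open>k\<close>.\<close>
  define t where "t = (\<lambda>k. of_nat ((2 * n) choose k) * (\<i> * complex_of_real x) ^ k)"
  have polar: "1 + \<i> * complex_of_real x = rcis (sqrt (1 + x\<^sup>2)) (arctan x)"
  proof -
    have "sqrt (1 + x\<^sup>2) > 0" by (smt (verit) real_sqrt_gt_zero zero_le_power2)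
    then show ?thesis by (simp add: complex_eq_iff cos_arctan sin_arctan)
  qed
  have even_term: "Re (t (2 * k)) = (-1) ^ k * real ((2 * n) choose (2 * k)) * (x ^ 2) ^ k" for k
  proof -
    have "(\<i> * complex_of_real x) ^ (2 * k) = complex_of_real ((-1) ^ k * (x ^ 2) ^ k)"
      by (simp add: power_mult power_mult_distrib power_minus[of "(complex_of_real x)\<^sup>2"])
    then show ?thesis by (simp add: t_def)
  qed
  have odd_term: "Re (t k) = 0" if "odd k" for k
  proof -
    from that obtain l where "k = 2 * l + 1" by (rule oddE)
    then have "(\<i> * complex_of_real x) ^ k = complex_of_real ((-1) ^ l * (x ^ 2) ^ l * x) * \<i>"
      by (simp add: power_mult power_mult_distrib power_minus[of "(complex_of_real x)\<^sup>2"])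
    then show ?thesis by (simp add: t_def)
  qed
  have "(\<Sum>k = 0..n. (-1) ^ k * real ((2 * n) choose (2 * k)) * (x ^ 2) ^ k) =
      (\<Sum>k = 0..n. Re (t (2 * k)))"
    by (simp add: even_term)
  also have "\<dots> = (\<Sum>k \<in> (*) 2 ` {0..n}. Re (t k))"
    by (subst sum.reindex) (auto simp: inj_on_def)
  \<comment> \<open>The added indices are odd, so they contribute nothing and the full expansion
    appears.\<close>
  also have "\<dots> = (\<Sum>k\<le>2 * n. Re (t k))"
  proof (rule sum.mono_neutral_left)
    show "\<forall>k\<in>{..2 * n} - (*) 2 ` {0..n}. Re (t k) = 0"
    proof
      fix k assume k: "k \<in> {..2 * n} - (*) 2 ` {0..n}"
      have "odd k"
      proof
        assume "even k"
        then obtain l where "k = 2 * l" by (rule evenE)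
        with k show False by auto
      qed
      then show "Re (t k) = 0" by (rule odd_term)
    qed
  qed auto
  also have "\<dots> = Re ((\<i> * complex_of_real x + 1) ^ (2 * n))"
    by (simp add: binomial_ring t_def)
  also have "\<dots> = sqrt (1 + x\<^sup>2) ^ (2 * n) * cos (2 * real n * arctan x)"
    using polar by (simp add: add.commute DeMoivre2)
  also have "sqrt (1 + x\<^sup>2) ^ (2 * n) = (1 + x\<^sup>2) ^ n"
    by (simp add: power_mult)
  finally show ?thesis .
qed

text \<open>As arctan (1/x) = sgn x * \<pi>/2 - arctan x, multiplying by 2n shifts the angle by n
  \<pi> up or down, and either direction gives the same sign.\<close>

lemma cos_arctan_inverse:
  fixes x :: real
  assumes "x \<noteq> 0"
  shows "cos (2 * real n * arctan (1 / x)) = (-1) ^ n * cos (2 * real n * arctan x)"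
proof -
  have "cos (2 * real n * arctan (1 / x)) = cos (2 * real n * arctan x - real n * (sgn x * pi))"
    by (subst cos_minus[symmetric]) (simp add: arctan_inverse[OF assms] algebra_simps)
  also have "\<dots> = (-1) ^ n * cos (2 * real n * arctan x)"
    using assms by (auto simp: sgn_if cos_diff cos_add)
  finally show ?thesis .
qed

lemma cos_arctan_minus_inverse:
  fixes x :: real
  assumes "x \<noteq> 0"
  shows "cos (2 * real n * arctan (- 1 / x)) = (-1) ^ n * cos (2 * real n * arctan x)"
  using cos_arctan_inverse[OF assms, of n] by (simp add: arctan_minus)

text \<open>The exponent splits as (j r)(2k) + j s, which leaves the even binomial sum at
  \<open>c powi (j * r)\<close> times a factor free of \<open>k\<close>.\<close>

lemma sum_alternating_binomial_powi:
  fixes c :: real and j r s :: int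
  assumes "c \<noteq> 0"
  shows "(\<Sum>k = 0..n. (-1) ^ k * real ((2 * n) choose (2 * k)) * c powi (j * (2 * r * int k + s))) =
    (1 + (c powi (j * r))\<^sup>2) ^ n * c powi (j * s) * cos (2 * real n * arctan (c powi (j * r)))"
proof -
  have "c powi (j * (2 * r * int k + s)) = ((c powi (j * r))\<^sup>2) ^ k * c powi (j * s)" for k
  proof -
    have "j * (2 * r * int k + s) = (j * r) * int (2 * k) + j * s"
      by (simp add: algebra_simps)
    then have "c powi (j * (2 * r * int k + s)) = c powi ((j * r) * int (2 * k)) * c powi (j * s)"
      using assms by (simp only: power_int_add simp_thms)
    also have "c powi ((j * r) * int (2 * k)) = ((c powi (j * r))\<^sup>2) ^ k"
      by (simp only: power_int_mult[of c "j * r"] power_int_of_nat power_mult)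
    finally show ?thesis .
  qed
  then have "(\<Sum>k = 0..n. (-1) ^ k * real ((2 * n) choose (2 * k)) * c powi (j * (2 * r * int k + s))) =
      (\<Sum>k = 0..n. (-1) ^ k * real ((2 * n) choose (2 * k)) * ((c powi (j * r))\<^sup>2) ^ k) * c powi (j * s)"
    by (simp only: sum_distrib_right mult.assoc)
  then show ?thesis
    unfolding sum_alternating_even_binomial by (simp only: mult_ac)
qed

context
  fixes \<alpha> \<beta> :: real
  defines "\<alpha> \<equiv> (1 + sqrt 5) / 2" and "\<beta> \<equiv> (1 - sqrt 5) / 2"
begin

lemma golden_mult: "\<alpha> * \<beta> = - 1"
  by (simp add: \<alpha>_def \<beta>_def field_simps)

lemma golden_nonzero: "\<alpha> \<noteq> 0" "\<beta> \<noteq> 0"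
  using golden_mult by auto

text \<open>Because \<alpha> \<beta> = -1, the inverse of each root is minus the other. This carries
  Binet's formulas to negative indices.\<close>

lemma golden_powi_minus:
  "\<alpha> powi (- int k) = (-1) ^ k * \<beta> ^ k" "\<beta> powi (- int k) = (-1) ^ k * \<alpha> ^ k"
proof -
  have "inverse \<alpha> = - \<beta>" "inverse \<beta> = - \<alpha>"
    using golden_mult golden_nonzero by (simp_all add: field_simps)
  then show "\<alpha> powi (- int k) = (-1) ^ k * \<beta> ^ k" "\<beta> powi (- int k) = (-1) ^ k * \<alpha> ^ k"
    by (simp_all add: power_int_minus power_minus[of \<alpha>] power_minus[of \<beta>] flip: power_inverse)
qed

lemma golden_powi_mult: "\<alpha> powi m * \<beta> powi m = (if even m then 1 else - 1)"
  by (simp add: power_int_mult_distrib[symmetric] golden_mult)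

text \<open>Both roots satisfy x^2 = x + 1, so their powers obey the Lucas recurrence.\<close>

lemma lucas_closed_form: "real (lucas n) = \<alpha> ^ n + \<beta> ^ n"
proof (induction n rule: lucas.induct)
  case (3 n)
  have "\<alpha> ^ 2 = \<alpha> + 1" "\<beta> ^ 2 = \<beta> + 1"
    by (simp_all add: \<alpha>_def \<beta>_def power2_eq_square field_simps)
  then have "\<alpha> ^ Suc (Suc n) = \<alpha> ^ n * (\<alpha> + 1)" "\<beta> ^ Suc (Suc n) = \<beta> ^ n * (\<beta> + 1)"
    by (simp_all add: power2_eq_square mult_ac)
  with 3 show ?case by (simp add: algebra_simps)
qed (simp_all add: \<alpha>_def \<beta>_def field_simps)

lemma binet_fib_int: "real_of_int (fib_int m) = (\<alpha> powi m - \<beta> powi m) / sqrt 5"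
proof -
  have nat: "real (fib k) = (\<alpha> ^ k - \<beta> ^ k) / sqrt 5" for k
    unfolding \<alpha>_def \<beta>_def by (rule fib_closed_form)
  show ?thesis
  proof (cases m rule: int_cases2)
    case (nonneg k)
    then show ?thesis by (simp add: nat)
  next
    case (nonpos k)
    \<comment> \<open>Passing to -k swaps the two roots, which turns the sign (-1)^k into the
      (-1)^(k+1) of \<open>fib_int_minus\<close>.\<close>
    then show ?thesis
      by (simp add: fib_int_minus nat golden_powi_minus field_simps)
  qed
qed

lemma binet_lucas_int: "real_of_int (lucas_int m) = \<alpha> powi m + \<beta> powi m"
proof (cases m rule: int_cases2)
  case (nonneg k)
  then show ?thesis by (simp add: lucas_closed_form)
next
  case (nonpos k)
  then show ?thesis
    by (simp add: lucas_int_minus lucas_closed_form golden_powi_minus field_simps)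
qed

text \<open>Both sums share the factors \<open>D\<close> and \<open>C\<close> and differ only by a
  sign, so Binet's formulas can recombine them. By Binet, \<open>D\<close> is \<alpha>^m - \<beta>^m
  for odd m = j r and \<alpha>^m + \<beta>^m for even m.\<close>

lemma sum_alternating_binomial_golden:
  fixes n :: nat and j r s :: int
  defines "C \<equiv> cos (2 * real n * arctan (\<alpha> powi (j * r)))"
  defines "D \<equiv> (if odd (j * r) then sqrt 5 * real_of_int (fib_int (j * r))
    else real_of_int (lucas_int (j * r)))"
  shows "(\<Sum>k = 0..n. (-1) ^ k * real ((2 * n) choose (2 * k)) * \<alpha> powi (j * (2 * r * int k + s))) =
      D ^ n * \<alpha> powi (j * r * int n + j * s) * C"
    and "(\<Sum>k = 0..n. (-1) ^ k * real ((2 * n) choose (2 * k)) * \<beta> powi (j * (2 * r * int k + s))) =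
      (if odd (j * r) then 1 else (-1) ^ n) * D ^ n * \<beta> powi (j * r * int n + j * s) * C"
proof -
  define x y where "x = \<alpha> powi (j * r)" and "y = \<beta> powi (j * r)"
  have xy: "x * y = (if odd (j * r) then - 1 else 1)"
    using golden_powi_mult[of "j * r"] by (simp add: x_def y_def)
  have x0: "x \<noteq> 0" by (simp add: x_def golden_nonzero)
  have D: "D = (if odd (j * r) then x - y else x + y)"
    by (simp add: D_def binet_fib_int binet_lucas_int x_def y_def)
  \<comment> \<open>The 1 is replaced by -x y for odd j r and by x y for even j r, after which x or
    y factors out.\<close>
  have sq_x: "1 + x\<^sup>2 = D * x" and sq_y: "1 + y\<^sup>2 = (if odd (j * r) then - 1 else 1) * D * y"
    using xy by (auto simp: D power2_eq_square algebra_simps)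
  have "y = (if odd (j * r) then - 1 / x else 1 / x)"
    using xy x0 by (auto simp: field_simps)
  then have cos_y: "cos (2 * real n * arctan y) = (-1) ^ n * C"
    using cos_arctan_inverse[OF x0, of n] cos_arctan_minus_inverse[OF x0, of n]
    by (simp add: C_def x_def)
  have shift: "c powi (j * r * int n + j * s) = (c powi (j * r)) ^ n * c powi (j * s)"
    if "c \<noteq> 0" for c :: real
    using that by (simp add: power_int_add power_int_mult[of c "j * r"])
  show "(\<Sum>k = 0..n. (-1) ^ k * real ((2 * n) choose (2 * k)) * \<alpha> powi (j * (2 * r * int k + s))) =
      D ^ n * \<alpha> powi (j * r * int n + j * s) * C"
    unfolding sum_alternating_binomial_powi[OF golden_nonzero(1)] shift[OF golden_nonzero(1)]
      x_def[symmetric] sq_x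
    by (simp add: C_def x_def power_mult_distrib)
  show "(\<Sum>k = 0..n. (-1) ^ k * real ((2 * n) choose (2 * k)) * \<beta> powi (j * (2 * r * int k + s))) =
      (if odd (j * r) then 1 else (-1) ^ n) * D ^ n * \<beta> powi (j * r * int n + j * s) * C"
    unfolding sum_alternating_binomial_powi[OF golden_nonzero(2)] shift[OF golden_nonzero(2)]
      y_def[symmetric] sq_y cos_y
    \<comment> \<open>For odd j r the (-1)^n from \<open>sq_y\<close> cancels the one from
      \<open>cos_y\<close>; for even j r only the latter is present.\<close>
    by (auto simp: power_mult_distrib simp flip: power_add mult_2)
qed

end

theorem theorem24:
  fixes \<alpha> :: real and n :: nat and j r s :: int
  assumes "\<alpha> = (1 + sqrt 5) / 2"
  shows
    "(\<Sum>k = 0..n. (-1) ^ k * real ((2 * n) choose (2 * k))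
        * real_of_int (fib_int (j * (2 * r * int k + s)))) =
      (if odd (j * r) then
         sqrt (5 ^ n) * real_of_int (fib_int (j * r)) ^ n
           * real_of_int (fib_int (j * r * int n + j * s))
           * cos (2 * real n * arctan (\<alpha> powi (j * r)))
       else if even n then
         real_of_int (lucas_int (j * r)) ^ n
           * real_of_int (fib_int (j * r * int n + j * s))
           * cos (2 * real n * arctan (\<alpha> powi (j * r)))
       else
         1 / sqrt 5 * real_of_int (lucas_int (j * r)) ^ n
           * real_of_int (lucas_int (j * r * int n + j * s))
           * cos (2 * real n * arctan (\<alpha> powi (j * r))))
     \<and>
     (\<Sum>k = 0..n. (-1) ^ k * real ((2 * n) choose (2 * k))
        * real_of_int (lucas_int (j * (2 * r * int k + s)))) =
      (if odd (j * r) then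
         sqrt (5 ^ n) * real_of_int (fib_int (j * r)) ^ n
           * real_of_int (lucas_int (j * r * int n + j * s))
           * cos (2 * real n * arctan (\<alpha> powi (j * r)))
       else if even n then
         real_of_int (lucas_int (j * r)) ^ n
           * real_of_int (lucas_int (j * r * int n + j * s))
           * cos (2 * real n * arctan (\<alpha> powi (j * r)))
       else
         sqrt 5 * real_of_int (lucas_int (j * r)) ^ n
           * real_of_int (fib_int (j * r * int n + j * s))
           * cos (2 * real n * arctan (\<alpha> powi (j * r))))"
proof -
  define \<beta> :: real where "\<beta> = (1 - sqrt 5) / 2"
  define w where "w = (\<lambda>k. (-1) ^ k * real ((2 * n) choose (2 * k)))"
  define e where "e = (\<lambda>k. j * (2 * r * int k + s))"
  define N where "N = j * r * int n + j * s"
  define C where "C = cos (2 * real n * arctan (\<alpha> powi (j * r)))"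
  \<comment> \<open>Outside the context the roots appear as explicit expressions; folding restores
    their names.\<close>
  note fib = binet_fib_int[folded assms \<beta>_def]
  note lucas = binet_lucas_int[folded assms \<beta>_def]
  define D where "D = (if odd (j * r) then sqrt 5 * real_of_int (fib_int (j * r))
    else real_of_int (lucas_int (j * r)))"
  have A: "(\<Sum>k = 0..n. w k * \<alpha> powi e k) = D ^ n * \<alpha> powi N * C"
    using sum_alternating_binomial_golden(1)[of n j r s, folded assms]
    by (simp only: w_def e_def N_def C_def D_def)
  have B: "(\<Sum>k = 0..n. w k * \<beta> powi e k) =
      (if odd (j * r) then 1 else (-1) ^ n) * D ^ n * \<beta> powi N * C"
    using sum_alternating_binomial_golden(2)[of n j r s, folded assms \<beta>_def]
    by (simp only: w_def e_def N_def C_def D_def)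
  have F: "(\<Sum>k = 0..n. w k * real_of_int (fib_int (e k))) =
      ((\<Sum>k = 0..n. w k * \<alpha> powi e k) - (\<Sum>k = 0..n. w k * \<beta> powi e k)) / sqrt 5"
    by (simp add: fib right_diff_distrib diff_divide_distrib sum_subtractf sum_divide_distrib)
  have L: "(\<Sum>k = 0..n. w k * real_of_int (lucas_int (e k))) =
      (\<Sum>k = 0..n. w k * \<alpha> powi e k) + (\<Sum>k = 0..n. w k * \<beta> powi e k)"
    by (simp add: lucas distrib_left sum.distrib)
  \<comment> \<open>This identifies the prefactor of the odd case as \<open>D ^ n\<close>.\<close>
  have P: "sqrt (5 ^ n) * real_of_int (fib_int (j * r)) ^ n =
      (sqrt 5 * real_of_int (fib_int (j * r))) ^ n"
    by (simp add: real_sqrt_power power_mult_distrib)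
  show ?thesis
    unfolding C_def[symmetric] N_def[symmetric]
    unfolding w_def[THEN fun_cong, symmetric] e_def[THEN fun_cong, symmetric]
    unfolding F L A B P fib[of N] lucas[of N]
    \<comment> \<open>When j r is even and n is odd, the \<beta>-sum enters with a minus sign, so
      differences and sums of powers trade places: Fibonacci and Lucas numbers swap, at the cost of
      a factor 1 / sqrt 5 or sqrt 5.\<close>
    by (simp add: D_def field_simps)
qed

end
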